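(* Let $X$ be a separable real Banach space containing an isomorphic copy of $c_0$. Then $\mathrm{GL}(X)$ contains a WOT-indiscrete bounded cyclic subgroup $G$ with a distinguished point in $X$. In particular, $G$ is not light.
   Context: $\mathrm{GL}(X)$ is the group of bounded linear isomorphisms of $X$ onto itself; a subgroup is bounded if it is bounded in operator norm. The Strong Operator Topology (SOT) is the topology of pointwise norm convergence on $X$; the Weak Operator Topology (WOT) is generated by the maps $T\mapsto x^*(Tx)$, $x\in X$, $x^*\in X^*$. $G$ is WOT-indiscrete if it is not discrete in the WOT. A point $x\in X$ is distinguished for $G$ if $\inf_{T\in G,\,T\neq \mathrm{Id}}\|Tx-x\|>0$. $G$ is light if the WOT and the SOT coincide on $G$. *)

theory Defs
  imports "HOL-Analysis.Analysis" "HOL-Algebra.Elementary_Groups"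
begin

text \<open>Since \<^typ>\<open>nat\<close> carries the discrete topology, \<^typ>\<open>nat \<Rightarrow>\<^sub>C real\<close> is the space of
  bounded real sequences with the supremum norm.\<close>

definition c0 :: "(nat \<Rightarrow>\<^sub>C real) set"
  where "c0 = {a. apply_bcontfun a \<longlonglongrightarrow> 0}"

text \<open>The linear subspace \<open>Y\<close> is not required to be closed: being linearly homeomorphic to the
  complete space \<^term>\<open>c0\<close>, it is complete.\<close>

definition contains_copy_of_c0 :: "'a::real_normed_vector itself \<Rightarrow> bool"
  where "contains_copy_of_c0 _ \<longleftrightarrow>
    (\<exists>(Y :: 'a set) J K. subspace Y \<and> homeomorphism c0 Y J K \<and>
       (\<forall>a\<in>c0. \<forall>b\<in>c0. J (a + b) = J a + J b) \<and>
       (\<forall>r. \<forall>a\<in>c0. J (r *\<^sub>R a) = r *\<^sub>R J a))"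

definition GL :: "('a::real_normed_vector \<Rightarrow>\<^sub>L 'a) monoid"
  where "GL = units_of \<lparr>carrier = UNIV, monoid.mult = (o\<^sub>L), one = id_blinfun\<rparr>"

lemma carrier_GL:
  "carrier GL = {T. \<exists>S. S o\<^sub>L T = id_blinfun \<and> T o\<^sub>L S = id_blinfun}"
  by (simp add: GL_def units_of_def Units_def)

definition weak_operator_topology ::
    "('a::real_normed_vector \<Rightarrow>\<^sub>L 'b::real_normed_vector) topology"
  where "weak_operator_topology = topology_generated_by
    {(\<lambda>T. blinfun_apply f (blinfun_apply T x)) -` U | (f :: 'b \<Rightarrow>\<^sub>L real) x U. open U}"

lemma topspace_weak_operator_topology [simp]: "topspace weak_operator_topology = UNIV"
proof -
  have "UNIV \<in> {(\<lambda>T. blinfun_apply f (blinfun_apply T x)) -` U |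
      (f :: 'b::real_normed_vector \<Rightarrow>\<^sub>L real) (x :: 'a::real_normed_vector) U. open U}"
    by (intro CollectI exI[of _ UNIV] exI) auto
  then show ?thesis
    unfolding weak_operator_topology_def topology_generated_by_topspace by blast
qed

definition WOT_indiscrete :: "('a::real_normed_vector \<Rightarrow>\<^sub>L 'a) set \<Rightarrow> bool"
  where "WOT_indiscrete G \<longleftrightarrow> subtopology weak_operator_topology G \<noteq> discrete_topology G"

text \<open>The infimum is taken in the extended reals, so that it is \<^term>\<open>\<infinity> :: ereal\<close> for the
  trivial group.\<close>

definition distinguished_point :: "('a::real_normed_vector \<Rightarrow>\<^sub>L 'a) set \<Rightarrow> 'a \<Rightarrow> bool"
  where "distinguished_point G x \<longleftrightarrow>
    (INF T \<in> G - {id_blinfun}. ereal (norm (blinfun_apply T x - x))) > 0"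

definition light :: "('a::real_normed_vector \<Rightarrow>\<^sub>L 'a) set \<Rightarrow> bool"
  where "light G \<longleftrightarrow>
    subtopology weak_operator_topology G = subtopology strong_operator_topology G"

end

theory Submission
  imports Defs
begin

text \<open>Let \<open>e\<^sub>0, e\<^sub>1, \<dots>\<close> be the unit vectors of the copy of \<open>c\<^sub>0\<close>, identify \<open>c\<^sub>0\<close> with the complex
  null sequences by pairing coordinates, and let \<open>g\<^sub>k\<close> be bounded extensions to \<open>X\<close> of
  the complex coordinates, perturbed so that \<open>g\<^sub>k e\<^sub>0 = 1\<close> for all \<open>k > 0\<close>. With
  \<open>\<lambda>\<^sub>k = exp (2 \<pi> i / 2\<^sup>k)\<close>, the operators \<open>T\<^sup>n x = x + ((\<lambda>\<^sub>k\<^sup>n - 1) g\<^sub>k x)\<^sub>k\<close> are well defined on all of \<open>X\<close>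
  even though \<open>(g\<^sub>k x)\<^sub>k\<close> is merely bounded, because \<open>\<lambda>\<^sub>k\<^sup>n \<rightarrow> 1\<close> as \<open>k \<rightarrow> \<infinity>\<close>; so Hahn-Banach suffices and
  no projection onto \<open>c\<^sub>0\<close> is needed. They form a bounded cyclic group. For \<open>n \<noteq> 0\<close> some \<open>\<lambda>\<^sub>k\<^sup>n\<close> equals
  \<open>-1\<close>, so \<open>T\<^sup>n\<close> moves \<open>e\<^sub>0\<close> by a fixed amount, whereas the displacements of \<open>x\<close> under the powers
  with \<open>n = 2\<^sup>j\<close> are bounded in \<open>c\<^sub>0\<close> and tend to 0 coordinatewise, hence weakly.\<close>

section \<open>Extension of functionals\<close>

text \<open>The one-dimensional step of Hahn-Banach. A value \<open>a\<close> at \<open>v\<close>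
  keeps the domination iff it lies above every \<open>r - C * norm (x - v)\<close> and below every
  \<open>C * norm (y + v) - q\<close>; by the triangle inequality each number of the first kind is
  at most each of the second, so the supremum of the first kind serves.\<close>

lemma dominated_graph_extend:
  fixes M :: "('a::real_normed_vector \<times> real) set"
  assumes "subspace M" and dom: "\<And>x r. (x, r) \<in> M \<Longrightarrow> r \<le> C * norm x" and "C \<ge> 0"
  obtains a where "\<And>x r. (x, r) \<in> span (insert (v, a) M) \<Longrightarrow> r \<le> C * norm x"
proof -
  have sep: "r - C * norm (x - v) \<le> C * norm (y + v) - q" if "(x, r) \<in> M" "(y, q) \<in> M" for x r y q
  proof -
    have "(x + y, r + q) \<in> M"
      using subspace_add[OF \<open>subspace M\<close> that] by simp
    then have "r + q \<le> C * norm (x + y)"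
      by (rule dom)
    also have "\<dots> \<le> C * (norm (x - v) + norm (y + v))"
      using norm_triangle_ineq[of "x - v" "y + v"] \<open>C \<ge> 0\<close> by (intro mult_left_mono) auto
    finally show ?thesis
      by (simp add: algebra_simps)
  qed
  have zero: "(0, 0) \<in> M"
    using subspace_0[OF \<open>subspace M\<close>] by (simp add: zero_prod_def)
  define L where "L = (\<lambda>(x, r). r - C * norm (x - v)) ` M"
  have "L \<noteq> {}"
    using zero by (auto simp: L_def)
  \<comment> \<open>The bound is \<open>sep\<close> against the pair \<open>(0, 0)\<close>.\<close>
  have bdd: "bdd_above L"
    using sep[OF _ zero] by (intro bdd_aboveI[of _ "C * norm v"]) (auto simp: L_def)
  define a where "a = Sup L"
  have lower: "r - C * norm (x - v) \<le> a" if "(x, r) \<in> M" for x r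
    unfolding a_def using that by (intro cSup_upper bdd) (force simp: L_def)
  have upper: "a \<le> C * norm (y + v) - q" if "(y, q) \<in> M" for y q
    unfolding a_def using that sep by (intro cSup_least \<open>L \<noteq> {}\<close>) (auto simp: L_def)
  have "r \<le> C * norm x" if xr: "(x, r) \<in> span (insert (v, a) M)" for x r
  proof -
    obtain k where k: "(x - k *\<^sub>R v, r - k * a) \<in> M"
      using xr unfolding span_breakdown_eq span_eq_iff[THEN iffD2, OF \<open>subspace M\<close>]
      by auto
    have scaled: "(c *\<^sub>R (x - k *\<^sub>R v), c * (r - k * a)) \<in> M" for c
      using subspace_scale[OF \<open>subspace M\<close> k] by simp
    \<comment> \<open>Dividing by the absolute value of \<open>k\<close> reduces the claim to
      coefficient 1 or -1 at \<open>v\<close>, which are the two conditions on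
      \<open>a\<close>.\<close>
    consider "k = 0" | "k > 0" | "k < 0" by linarith
    then show ?thesis
    proof cases
      case 1
      then show ?thesis using dom k by simp
    next
      case 2
      have *: "(1 / k) *\<^sub>R (x - k *\<^sub>R v) + v = (1 / k) *\<^sub>R x"
        using 2 by (simp add: algebra_simps)
      show ?thesis
        using upper[OF scaled[of "1 / k"]] 2 unfolding * by (simp add: field_simps)
    next
      case 3
      have *: "(- 1 / k) *\<^sub>R (x - k *\<^sub>R v) - v = (- 1 / k) *\<^sub>R x"
        using 3 by (simp add: algebra_simps)
      show ?thesis
        using lower[OF scaled[of "- 1 / k"]] 3 unfolding * by (simp add: field_simps)
    qed
  qed
  then show ?thesis
    using that by blast
qed

lemma subspace_Union_chain:
  assumes "\<C> \<noteq> {}" and "subset.chain UNIV \<C>" and "\<And>S. S \<in> \<C> \<Longrightarrow> subspace S"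
  shows "subspace (\<Union>\<C>)"
proof (rule subspaceI)
  show "0 \<in> \<Union>\<C>"
    using assms subspace_0 by blast
  show "x + y \<in> \<Union>\<C>" if xy: "x \<in> \<Union>\<C>" "y \<in> \<Union>\<C>" for x y
  proof -
    obtain S T where ST: "S \<in> \<C>" "T \<in> \<C>" "x \<in> S" "y \<in> T"
      using xy by blast
    then have "S \<subseteq> T \<or> T \<subseteq> S"
      using assms(2) by (auto simp: subset.chain_def)
    then show ?thesis
      using ST assms(3) subspace_add by (metis UnionI subsetD)
  qed
  show "c *\<^sub>R x \<in> \<Union>\<C>" if "x \<in> \<Union>\<C>" for c x
    using that assms(3) subspace_scale by blast
qed

text \<open>A functional on a subspace is given by its graph; a dominated linear relation is
  automatically single-valued.\<close>

theorem Hahn_Banach_graph: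
  fixes F :: "('a::real_normed_vector \<times> real) set"
  assumes "subspace F" and dom: "\<And>x r. (x, r) \<in> F \<Longrightarrow> r \<le> C * norm x" and "C \<ge> 0"
  obtains f :: "'a \<Rightarrow>\<^sub>L real"
    where "\<And>x r. (x, r) \<in> F \<Longrightarrow> blinfun_apply f x = r" and "\<And>x. \<bar>blinfun_apply f x\<bar> \<le> C * norm x"
proof -
  define \<A> where "\<A> = {M. subspace M \<and> F \<subseteq> M \<and> (\<forall>(x, r) \<in> M. r \<le> C * norm x)}"
  have "\<exists>M\<in>\<A>. \<forall>X\<in>\<A>. M \<subseteq> X \<longrightarrow> X = M"
  proof (rule subset_Zorn_nonempty)
    show "\<A> \<noteq> {}"
      using assms by (auto simp: \<A>_def)
    fix \<C> assume \<C>: "\<C> \<noteq> {}" "subset.chain \<A> \<C>"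
    then have "\<C> \<subseteq> \<A>" "subset.chain UNIV \<C>"
      by (auto simp: subset.chain_def)
    then have "subspace (\<Union>\<C>)"
      using \<C> by (intro subspace_Union_chain) (auto simp: \<A>_def)
    with \<open>\<C> \<subseteq> \<A>\<close> \<open>\<C> \<noteq> {}\<close> show "\<Union>\<C> \<in> \<A>"
      by (fastforce simp: \<A>_def)
  qed
  then obtain M where M: "M \<in> \<A>" and maximal: "\<And>X. X \<in> \<A> \<Longrightarrow> M \<subseteq> X \<Longrightarrow> X = M"
    by blast
  have sub: "subspace M" and "F \<subseteq> M" and domM: "\<And>x r. (x, r) \<in> M \<Longrightarrow> r \<le> C * norm x"
    using M by (auto simp: \<A>_def)
  \<comment> \<open>The differences \<open>(0, r - q)\<close> and \<open>(0, q - r)\<close> lie in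
    \<open>M\<close>, and domination at 0 makes both second entries nonpositive.\<close>
  have unique: "r = q" if "(x, r) \<in> M" "(x, q) \<in> M" for x r q
    using domM[of 0 "r - q"] domM[of 0 "q - r"] subspace_diff[OF sub that] subspace_diff[OF sub that(2,1)]
    by simp
  have total: "\<exists>r. (v, r) \<in> M" for v
  proof -
    obtain a where a: "\<And>x r. (x, r) \<in> span (insert (v, a) M) \<Longrightarrow> r \<le> C * norm x"
      using dominated_graph_extend[OF sub domM \<open>C \<ge> 0\<close>] by metis
    have le: "insert (v, a) M \<subseteq> span (insert (v, a) M)"
      by (rule span_superset)
    then have "span (insert (v, a) M) \<in> \<A>"
      using a \<open>F \<subseteq> M\<close> by (auto simp: \<A>_def subspace_span)
    then have "span (insert (v, a) M) = M"
      using maximal le by blast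
    with le show ?thesis by blast
  qed
  then obtain g where g: "\<And>v. (v, g v) \<in> M"
    by metis
  have geq: "(x, r) \<in> M \<longleftrightarrow> g x = r" for x r
    using g unique by blast
  have bound: "\<bar>g x\<bar> \<le> C * norm x" for x
    using domM[OF g, of x] domM[of "- x" "- g x"] subspace_neg[OF sub g, of x] by simp
  have "bounded_linear g"
  proof (rule bounded_linear_intro)
    show "g (x + y) = g x + g y" for x y
      using subspace_add[OF sub g[of x] g[of y]] by (simp add: geq)
    show "g (r *\<^sub>R x) = r *\<^sub>R g x" for r x
      using subspace_scale[OF sub g[of x], of r] by (simp add: geq)
    show "norm (g x) \<le> norm x * C" for x
      using bound[of x] by (simp add: mult.commute)
  qed
  then show ?thesis
    using that[of "Blinfun g"] \<open>F \<subseteq> M\<close> bound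
    by (metis bounded_linear_Blinfun_apply geq subsetD)
qed

section \<open>Copies of the space of null sequences\<close>

text \<open>Continuity at 0 bounds \<open>f\<close> by 1 on vectors of norm below some
  \<open>d\<close>; rescaling to norm \<open>d / 2\<close> gives the constant \<open>2 / d\<close>.
  This applies to the embedding of \<open>c0\<close> and to its inverse on the image.\<close>

lemma homogeneous_continuous_imp_bounded:
  fixes f :: "'a::real_normed_vector \<Rightarrow> 'b::real_normed_vector"
  assumes cont: "continuous_on S f" and "0 \<in> S"
    and scale: "\<And>r x. x \<in> S \<Longrightarrow> r *\<^sub>R x \<in> S \<and> f (r *\<^sub>R x) = r *\<^sub>R f x"
  obtains C where "\<And>x. x \<in> S \<Longrightarrow> norm (f x) \<le> C * norm x"
proof -
  have f0: "f 0 = 0"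
    using scale[OF \<open>0 \<in> S\<close>, of 0] by simp
  obtain d where "d > 0" and d: "\<And>x. x \<in> S \<Longrightarrow> norm x < d \<Longrightarrow> norm (f x) < 1"
    using cont \<open>0 \<in> S\<close> f0 unfolding continuous_on_iff by (metis dist_0_norm dist_commute zero_less_one)
  have "norm (f x) \<le> (2 / d) * norm x" if "x \<in> S" for x
  proof (cases "x = 0")
    case False
    define r where "r = d / (2 * norm x)"
    have "r > 0"
      using False \<open>d > 0\<close> by (simp add: r_def)
    have "norm (r *\<^sub>R x) < d"
      using False \<open>d > 0\<close> by (simp add: r_def)
    then have "r * norm (f x) < 1"
      using d[of "r *\<^sub>R x"] scale[OF that, of r] \<open>r > 0\<close> by simp
    then show ?thesis
      using False \<open>d > 0\<close> by (simp add: r_def field_simps)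
  qed (simp add: f0)
  then show ?thesis
    using that by blast
qed

text \<open>Plain sequences replace bounded continuous functions, so only values of \<open>J\<close>
  at null sequences matter. The supremum norm is expressed by pointwise bounds: \<open>upper\<close>
  is continuity of the embedding, \<open>lower\<close> continuity of its inverse, read off
  coordinate by coordinate.\<close>

locale c0_embedding =
  fixes J :: "(nat \<Rightarrow> real) \<Rightarrow> 'a::real_normed_vector" and M m :: real
  assumes add: "s \<longlonglongrightarrow> 0 \<Longrightarrow> t \<longlonglongrightarrow> 0 \<Longrightarrow> J (\<lambda>n. s n + t n) = J s + J t"
    and scale: "s \<longlonglongrightarrow> 0 \<Longrightarrow> J (\<lambda>n. c * s n) = c *\<^sub>R J s"
    and upper: "s \<longlonglongrightarrow> 0 \<Longrightarrow> (\<And>n. \<bar>s n\<bar> \<le> b) \<Longrightarrow> norm (J s) \<le> M * b"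
    and lower: "s \<longlonglongrightarrow> 0 \<Longrightarrow> \<bar>s n\<bar> \<le> m * norm (J s)"

lemma apply_Bcontfun_null_sequence:
  fixes s :: "nat \<Rightarrow> real"
  assumes "s \<longlonglongrightarrow> 0"
  shows "apply_bcontfun (Bcontfun s) = s"
proof -
  have "s \<in> bcontfun"
    using convergent_imp_bounded[OF assms] by (auto simp: bcontfun_def)
  then show ?thesis
    by (rule Bcontfun_inverse)
qed

lemma contains_copy_of_c0_imp_embedding:
  assumes "contains_copy_of_c0 TYPE('a::real_normed_vector)"
  obtains J :: "(nat \<Rightarrow> real) \<Rightarrow> 'a::real_normed_vector" and M m where "c0_embedding J M m"
proof -
  obtain Y :: "'a set" and j k where Y: "subspace Y" and hom: "homeomorphism c0 Y j k"
    and add: "\<And>a b. a \<in> c0 \<Longrightarrow> b \<in> c0 \<Longrightarrow> j (a + b) = j a + j b"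
    and scale: "\<And>r a. a \<in> c0 \<Longrightarrow> j (r *\<^sub>R a) = r *\<^sub>R j a"
    using assms unfolding contains_copy_of_c0_def by blast
  have c0_0: "0 \<in> c0"
    by (simp add: c0_def)
  have c0_scale: "r *\<^sub>R a \<in> c0" if "a \<in> c0" for r a
    using that tendsto_mult_right_zero[of "apply_bcontfun a" sequentially r] by (simp add: c0_def)
  have jY: "j a \<in> Y" and kj: "k (j a) = a" if "a \<in> c0" for a
    using hom that by (auto simp: homeomorphism_def)
  have jk: "k y \<in> c0" "j (k y) = y" if "y \<in> Y" for y
    using hom that by (auto simp: homeomorphism_def)
  obtain M where M: "\<And>a. a \<in> c0 \<Longrightarrow> norm (j a) \<le> M * norm a"
    using homogeneous_continuous_imp_bounded[of c0 j] homeomorphism_cont1[OF hom] c0_0 c0_scale scale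
    by metis
  have "k (r *\<^sub>R y) = r *\<^sub>R k y" if "y \<in> Y" for r y
    using kj[of "r *\<^sub>R k y"] jk[OF that] c0_scale scale by metis
  then obtain m where m: "\<And>y. y \<in> Y \<Longrightarrow> norm (k y) \<le> m * norm y"
    using homogeneous_continuous_imp_bounded[of Y k] homeomorphism_cont2[OF hom] Y
      subspace_0 subspace_scale by metis
  define E where "E = (Bcontfun :: (nat \<Rightarrow> real) \<Rightarrow> _)"
  have apply_E: "apply_bcontfun (E s) = s" if "s \<longlonglongrightarrow> 0" for s
    using that unfolding E_def by (rule apply_Bcontfun_null_sequence)
  have E_c0: "E s \<in> c0" if "s \<longlonglongrightarrow> 0" for s
    using that apply_E by (simp add: c0_def)
  \<comment> \<open>The sign of \<open>M\<close> is unknown here, and enlarging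
    \<open>norm (E s)\<close> to \<open>b\<close> requires a nonnegative factor.\<close>
  have "c0_embedding (\<lambda>s. j (E s)) \<bar>M\<bar> m"
  proof
    fix s t :: "nat \<Rightarrow> real" and c b :: real and n
    assume s: "s \<longlonglongrightarrow> 0"
    show "j (E (\<lambda>n. s n + t n)) = j (E s) + j (E t)" if t: "t \<longlonglongrightarrow> 0"
    proof -
      have "E (\<lambda>n. s n + t n) = E s + E t"
        using s t tendsto_add_zero[OF s t] by (intro bcontfun_eqI) (simp add: apply_E)
      then show ?thesis
        using add s t E_c0 by simp
    qed
    show "j (E (\<lambda>n. c * s n)) = c *\<^sub>R j (E s)"
    proof -
      have "E (\<lambda>n. c * s n) = c *\<^sub>R E s"
        using s tendsto_mult_right_zero[OF s, of c] by (intro bcontfun_eqI) (simp add: apply_E)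
      then show ?thesis
        using scale s E_c0 by simp
    qed
    show "norm (j (E s)) \<le> \<bar>M\<bar> * b" if "\<And>n. \<bar>s n\<bar> \<le> b"
    proof -
      have "norm (E s) \<le> b"
        using that s by (intro norm_bound) (simp add: apply_E)
      then have "\<bar>M\<bar> * norm (E s) \<le> \<bar>M\<bar> * b"
        by (intro mult_left_mono) auto
      moreover have "M * norm (E s) \<le> \<bar>M\<bar> * norm (E s)"
        by (intro mult_right_mono) auto
      ultimately show ?thesis
        using M[OF E_c0[OF s]] by linarith
    qed
    show "\<bar>s n\<bar> \<le> m * norm (j (E s))"
      using norm_bounded[of "E s" n] m[OF jY[OF E_c0[OF s]]] kj[OF E_c0[OF s]] s
      by (simp add: apply_E)
  qed
  then show ?thesis
    using that by blast
qed

context c0_embedding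
begin

lemma zero: "J (\<lambda>_. 0) = 0"
  using scale[of "\<lambda>_. 0" 0] by simp

lemma M_nonneg: "M \<ge> 0"
  using upper[of "\<lambda>_. 0" 1] norm_ge_zero[of "J (\<lambda>_. 0)"] by (simp add: zero)

definition unit :: "nat \<Rightarrow> nat \<Rightarrow> real"
  where "unit n i = (if i = n then 1 else 0)"

lemma unit_null: "unit n \<longlonglongrightarrow> 0"
proof (rule tendsto_eventually)
  show "\<forall>\<^sub>F i in sequentially. unit n i = 0"
    using eventually_gt_at_top[of n] by eventually_elim (simp add: unit_def)
qed

lemma m_pos: "m > 0"
proof -
  have "1 \<le> m * norm (J (unit 0))"
    using lower[OF unit_null, of 0 0] by (simp add: unit_def)
  then have "m * norm (J (unit 0)) > 0"
    by linarith
  then show ?thesis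
    by (simp add: zero_less_mult_iff)
qed

section \<open>Unit vector expansions and weak convergence in the copy of \<open>c0\<close>\<close>

definition truncate :: "nat \<Rightarrow> (nat \<Rightarrow> real) \<Rightarrow> nat \<Rightarrow> real"
  where "truncate N s i = (if i < N then s i else 0)"

lemma truncate_null: "truncate N s \<longlonglongrightarrow> 0"
proof (rule tendsto_eventually)
  show "\<forall>\<^sub>F i in sequentially. truncate N s i = 0"
    using eventually_ge_at_top[of N] by eventually_elim (simp add: truncate_def)
qed

lemma J_truncate: "J (truncate N s) = (\<Sum>i<N. s i *\<^sub>R J (unit i))"
proof (induction N)
  case 0
  have "truncate 0 s = (\<lambda>_. 0)"
    by (simp add: truncate_def fun_eq_iff)
  then show ?case
    by (simp add: zero)
next
  case (Suc N)
  have "truncate (Suc N) s = (\<lambda>i. truncate N s i + s N * unit N i)"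
    by (auto simp: truncate_def unit_def fun_eq_iff less_Suc_eq)
  then show ?case
    using add[OF truncate_null tendsto_mult_right_zero[OF unit_null]] scale[OF unit_null] Suc by simp
qed

text \<open>The dual of \<open>c0\<close> is l^1: testing \<open>h\<close> on truncated sign
  sequences, of supremum norm at most 1, bounds all partial sums by
  \<open>norm h * M\<close>.\<close>

lemma summable_functional_coordinates:
  fixes h :: "'a \<Rightarrow>\<^sub>L real"
  shows "summable (\<lambda>i. \<bar>blinfun_apply h (J (unit i))\<bar>)"
proof (rule summableI_nonneg_bounded)
  fix N
  define s where "s i = sgn (blinfun_apply h (J (unit i)))" for i
  have "(\<Sum>i<N. \<bar>blinfun_apply h (J (unit i))\<bar>) = blinfun_apply h (J (truncate N s))"
    by (simp add: J_truncate blinfun.sum_right blinfun.scaleR_right s_def mult.commute abs_sgn)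
  also have "\<dots> \<le> norm h * norm (J (truncate N s))"
    using norm_blinfun[of h "J (truncate N s)"] by simp
  also have "\<dots> \<le> norm h * (M * 1)"
    by (intro mult_left_mono upper truncate_null) (auto simp: truncate_def s_def abs_sgn_eq)
  finally show "(\<Sum>i<N. \<bar>blinfun_apply h (J (unit i))\<bar>) \<le> norm h * M"
    by simp
qed simp

lemma J_sums:
  assumes s: "s \<longlonglongrightarrow> 0"
  shows "(\<lambda>i. s i *\<^sub>R J (unit i)) sums J s"
  unfolding sums_def J_truncate[symmetric]
proof (rule LIMSEQ_I)
  fix r :: real assume "r > 0"
  \<comment> \<open>The summand 1 covers \<open>M = 0\<close> and makes \<open>M * e < r\<close>
    strict.\<close>
  define e where "e = r / (M + 1)"
  have "e > 0"
    using M_nonneg \<open>r > 0\<close> by (simp add: e_def)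
  then obtain N0 where N0: "\<And>i. i \<ge> N0 \<Longrightarrow> \<bar>s i\<bar> < e"
    using LIMSEQ_D[OF s, of e] by auto
  have "norm (J (truncate N s) - J s) < r" if "N \<ge> N0" for N
  proof -
    let ?d = "\<lambda>i. truncate N s i + (- 1) * s i"
    have d: "?d \<longlonglongrightarrow> 0"
      by (intro tendsto_add_zero truncate_null tendsto_mult_right_zero s)
    have "J ?d = J (truncate N s) - J s"
      using add[OF truncate_null tendsto_mult_right_zero[OF s, of "- 1"]] scale[OF s, of "- 1"] by simp
    moreover have "norm (J ?d) \<le> M * e"
      using N0 that \<open>e > 0\<close> by (intro upper d) (auto simp: truncate_def intro: less_imp_le)
    moreover have "M * e < r"
      using M_nonneg \<open>r > 0\<close> by (simp add: e_def field_simps)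
    ultimately show ?thesis
      by simp
  qed
  then show "\<exists>N0. \<forall>N\<ge>N0. norm (J (truncate N s) - J s) < r"
    by blast
qed

text \<open>Dominated convergence for series: expanding along the unit vectors, the terms are
  majorised by \<open>b\<close> times the summable values of \<open>h\<close> there.\<close>

lemma weakly_null_if_pointwise_null:
  fixes t :: "nat \<Rightarrow> nat \<Rightarrow> real" and h :: "'a \<Rightarrow>\<^sub>L real"
  assumes null: "\<And>j. t j \<longlonglongrightarrow> 0" and bound: "\<And>j i. \<bar>t j i\<bar> \<le> b"
    and pointwise: "\<And>i. (\<lambda>j. t j i) \<longlonglongrightarrow> 0"
  shows "(\<lambda>j. blinfun_apply h (J (t j))) \<longlonglongrightarrow> 0"
proof -
  let ?h = "\<lambda>i. blinfun_apply h (J (unit i))"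
  have "(\<lambda>i. t j i * ?h i) sums blinfun_apply h (J (t j))" for j
    using bounded_linear.sums[OF blinfun.bounded_linear_right J_sums[OF null], of h j]
    by (simp add: blinfun.scaleR_right)
  then have eq: "blinfun_apply h (J (t j)) = (\<Sum>i. t j i * ?h i)" for j
    by (simp add: sums_iff)
  have "(\<lambda>j. \<Sum>i. t j i * ?h i) \<longlonglongrightarrow> (\<Sum>i. 0)"
  proof (rule tannerys_theorem[THEN conjunct2, THEN conjunct2])
    show "(\<lambda>j. t j i * ?h i) \<longlonglongrightarrow> 0" for i
      by (rule tendsto_mult_left_zero[OF pointwise])
    show "\<forall>\<^sub>F (i, j) in sequentially \<times>\<^sub>F sequentially. norm (t j i * ?h i) \<le> b * \<bar>?h i\<bar>"
      using bound by (intro always_eventually) (auto simp: abs_mult intro: mult_right_mono)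
    show "summable (\<lambda>i. b * \<bar>?h i\<bar>)"
      by (intro summable_mult summable_functional_coordinates)
  qed simp
  then show ?thesis
    by (simp add: eq)
qed

text \<open>On the image of \<open>J\<close> the coordinates are dominated by
  \<open>m * norm x\<close> because of \<open>lower\<close>; Hahn-Banach extends each with the same
  constant, so the extensions are uniformly bounded.\<close>

lemma coordinate_functionals:
  obtains f :: "nat \<Rightarrow> 'a \<Rightarrow>\<^sub>L real"
  where "\<And>n s. s \<longlonglongrightarrow> 0 \<Longrightarrow> blinfun_apply (f n) (J s) = s n"
    and "\<And>n x. \<bar>blinfun_apply (f n) x\<bar> \<le> m * norm x"
proof -
  have "\<exists>f :: 'a \<Rightarrow>\<^sub>L real. (\<forall>s. s \<longlonglongrightarrow> 0 \<longrightarrow> blinfun_apply f (J s) = s n) \<and>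
      (\<forall>x. \<bar>blinfun_apply f x\<bar> \<le> m * norm x)" for n
  proof -
    define F where "F = {(J s, s n) | s. s \<longlonglongrightarrow> 0}"
    have "subspace F"
    proof (rule subspaceI)
      have "(J (\<lambda>_. 0), 0) \<in> F"
        unfolding F_def using tendsto_const[of "0::real"] by blast
      then show "0 \<in> F"
        by (simp add: zero zero_prod_def)
    next
      fix x y assume "x \<in> F" "y \<in> F"
      then obtain s t where "s \<longlonglongrightarrow> 0" "x = (J s, s n)" "t \<longlonglongrightarrow> 0" "y = (J t, t n)"
        by (auto simp: F_def)
      then show "x + y \<in> F"
        unfolding F_def using add[of s t]
        by (intro CollectI exI[of _ "\<lambda>i. s i + t i"]) (simp add: tendsto_add_zero)
    next
      fix c x assume "x \<in> F"
      then obtain s where "s \<longlonglongrightarrow> 0" "x = (J s, s n)"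
        by (auto simp: F_def)
      then show "c *\<^sub>R x \<in> F"
        unfolding F_def using scale[of s c]
        by (intro CollectI exI[of _ "\<lambda>i. c * s i"]) (simp add: tendsto_mult_right_zero)
    qed
    moreover have "r \<le> m * norm x" if "(x, r) \<in> F" for x r
      using that lower[of _ n] by (force simp: F_def)
    ultimately obtain f :: "'a \<Rightarrow>\<^sub>L real"
      where f: "\<And>x r. (x, r) \<in> F \<Longrightarrow> blinfun_apply f x = r" "\<And>x. \<bar>blinfun_apply f x\<bar> \<le> m * norm x"
      using Hahn_Banach_graph[of F m] m_pos by (metis less_imp_le)
    have "blinfun_apply f (J s) = s n" if "s \<longlonglongrightarrow> 0" for s
      using f(1)[of "J s" "s n"] that by (auto simp: F_def)
    then show ?thesis
      using f(2) by blast
  qed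
  then obtain f :: "nat \<Rightarrow> 'a \<Rightarrow>\<^sub>L real"
    where "\<forall>n. (\<forall>s. s \<longlonglongrightarrow> 0 \<longrightarrow> blinfun_apply (f n) (J s) = s n) \<and>
      (\<forall>x. \<bar>blinfun_apply (f n) x\<bar> \<le> m * norm x)"
    by metis
  then show ?thesis
    using that by blast
qed

end

section \<open>The group of rotations\<close>

text \<open>The power \<open>\<lambda>\<^sub>k\<^sup>n\<close> of the overview. Index 0 carries the
  trivial rotation, which leaves room for the perturbation of the coordinates.\<close>

definition rot :: "int \<Rightarrow> nat \<Rightarrow> complex"
  where "rot n k = cis (2 * pi * (of_int n / 2 ^ k))"

lemma rot_zero [simp]: "rot 0 k = 1"
  by (simp add: rot_def)

lemma rot_at_0 [simp]: "rot n 0 = 1"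
  by (simp add: rot_def)

lemma rot_add: "rot (a + b) k = rot a k * rot b k"
  by (simp add: rot_def cis_mult add_divide_distrib distrib_left)

lemma norm_rot_minus_1: "norm (rot n k - 1) \<le> 2"
  using norm_triangle_ineq4[of "rot n k" 1] by (simp add: rot_def)

lemma rot_tendsto_1: "rot n \<longlonglongrightarrow> 1"
proof -
  have "(\<lambda>k. of_int n / 2 ^ k :: real) \<longlonglongrightarrow> 0"
    by (rule LIMSEQ_divide_realpow_zero) simp
  then have "rot n \<longlonglongrightarrow> cis (2 * pi * 0)"
    unfolding rot_def[abs_def] by (intro tendsto_cis tendsto_mult tendsto_const)
  then show ?thesis
    by simp
qed

lemma rot_power_of_2: "k \<le> j \<Longrightarrow> rot (2 ^ j) k = 1"
  by (simp add: rot_def power_diff[symmetric])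

text \<open>If \<open>n\<close> is \<open>2 ^ j\<close> times an odd number, then at index
  \<open>j + 1\<close> the angle is an odd multiple of \<open>pi\<close>.\<close>

lemma rot_eq_minus_1:
  assumes "n \<noteq> 0"
  obtains k where "k \<noteq> 0" "rot n k = - 1"
proof -
  define j where "j = multiplicity 2 n"
  obtain q where q: "n = 2 ^ j * q" "\<not> 2 dvd q"
    using multiplicity_decompose'[of n 2] assms unfolding j_def by auto
  then obtain r where r: "q = 2 * r + 1"
    by (auto elim: oddE)
  have "2 * pi * (of_int n / 2 ^ Suc j) = 2 * pi * of_int r + pi"
    by (simp add: q r field_simps)
  then have "rot n (Suc j) = - 1"
    by (simp add: rot_def cis_mult[symmetric] del: power_Suc)
  then show ?thesis
    using that by blast
qed

text \<open>Identifies complex sequences with real ones, so that complex rotations can act on a real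
  space.\<close>

definition interleave :: "(nat \<Rightarrow> complex) \<Rightarrow> nat \<Rightarrow> real"
  where "interleave z i = (if even i then Re (z (i div 2)) else Im (z (i div 2)))"

lemma interleave_even [simp]: "interleave z (2 * k) = Re (z k)"
  and interleave_odd [simp]: "interleave z (Suc (2 * k)) = Im (z k)"
  by (simp_all add: interleave_def)

lemma interleave_0 [simp]: "interleave z 0 = Re (z 0)"
  by (simp add: interleave_def)

lemma abs_interleave_le: "\<bar>interleave z i\<bar> \<le> norm (z (i div 2))"
  by (simp add: interleave_def abs_Re_le_cmod abs_Im_le_cmod)

lemma interleave_add: "interleave (\<lambda>k. y k + z k) = (\<lambda>i. interleave y i + interleave z i)"
  by (simp add: fun_eq_iff interleave_def)

lemma interleave_scaleR: "interleave (\<lambda>k. c *\<^sub>R z k) = (\<lambda>i. c * interleave z i)"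
  by (simp add: fun_eq_iff interleave_def)

lemma interleave_null:
  assumes "z \<longlonglongrightarrow> 0"
  shows "interleave z \<longlonglongrightarrow> 0"
proof (rule Lim_null_comparison)
  show "\<forall>\<^sub>F i in sequentially. norm (interleave z i) \<le> norm (z (i div 2))"
    by (simp add: abs_interleave_le)
  have "filterlim (\<lambda>i::nat. i div 2) sequentially sequentially"
    unfolding filterlim_at_top
  proof
    show "\<forall>\<^sub>F i in sequentially. Z \<le> i div 2" for Z :: nat
      using eventually_ge_at_top[of "2 * Z"] by eventually_elim simp
  qed
  then show "(\<lambda>i. norm (z (i div 2))) \<longlonglongrightarrow> 0"
    by (rule filterlim_compose[OF tendsto_norm_zero[OF assms]])
qed


section \<open>The operators \<open>T n\<close> and their displacements\<close>

locale c0_rotations = c0_embedding J M m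
  for J :: "(nat \<Rightarrow> real) \<Rightarrow> 'a::real_normed_vector" and M m +
  fixes f :: "nat \<Rightarrow> 'a \<Rightarrow>\<^sub>L real"
  assumes f_J: "s \<longlonglongrightarrow> 0 \<Longrightarrow> blinfun_apply (f n) (J s) = s n"
    and f_bound: "\<bar>blinfun_apply (f n) x\<bar> \<le> m * norm x"
begin

text \<open>Adding the coordinate \<^term>\<open>f 0\<close> to all real parts makes every \<^term>\<open>coord x k\<close> with
  \<^term>\<open>k \<noteq> 0\<close> equal to 1 at the single vector \<^term>\<open>J (unit 0)\<close>, although the \<open>coord x\<close> need not
  be a null sequence.\<close>

definition coord :: "'a \<Rightarrow> nat \<Rightarrow> complex"
  where "coord x k = Complex (blinfun_apply (f (2 * k)) x + blinfun_apply (f 0) x)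
    (blinfun_apply (f (Suc (2 * k))) x)"

lemma coord_add: "coord (x + y) k = coord x k + coord y k"
  by (simp add: coord_def blinfun.add_right complex_eq_iff)

lemma coord_scaleR: "coord (c *\<^sub>R x) k = c *\<^sub>R coord x k"
  by (simp add: coord_def blinfun.scaleR_right complex_eq_iff distrib_left)

text \<open>The factor 3 counts the functionals that enter \<open>coord\<close>.\<close>

lemma norm_coord_le: "norm (coord x k) \<le> 3 * m * norm x"
proof -
  have "norm (coord x k) \<le> \<bar>blinfun_apply (f (2 * k)) x + blinfun_apply (f 0) x\<bar>
      + \<bar>blinfun_apply (f (Suc (2 * k))) x\<bar>"
    using cmod_le[of "coord x k"] by (simp add: coord_def)
  then show ?thesis
    using f_bound[of "2 * k" x] f_bound[of 0 x] f_bound[of "Suc (2 * k)" x] by linarith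
qed

text \<open>Since \<open>z 0 = 0\<close>, the perturbing functional \<open>f 0\<close> vanishes at
  this vector, and \<open>coord\<close> recovers the unperturbed coordinates.\<close>

lemma coord_J_interleave:
  assumes "z \<longlonglongrightarrow> 0" and "z 0 = 0"
  shows "coord (J (interleave z)) k = z k"
  using f_J[OF interleave_null[OF assms(1)]] assms(2) by (simp add: coord_def complex_eq_iff)

definition displacement :: "int \<Rightarrow> 'a \<Rightarrow> nat \<Rightarrow> complex"
  where "displacement n x k = (rot n k - 1) * coord x k"

lemma abs_interleave_displacement_le: "\<bar>interleave (displacement n x) i\<bar> \<le> 2 * (3 * m * norm x)"
proof (rule order_trans[OF abs_interleave_le])
  show "norm (displacement n x (i div 2)) \<le> 2 * (3 * m * norm x)"
    unfolding displacement_def norm_mult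
    by (intro mult_mono norm_rot_minus_1 norm_coord_le) auto
qed

text \<open>The coordinates of \<^term>\<open>x\<close> are only bounded, but for fixed \<^term>\<open>n\<close> the rotations
  tend to the identity.\<close>

lemma displacement_null: "displacement n x \<longlonglongrightarrow> 0"
proof (rule Lim_null_comparison)
  show "\<forall>\<^sub>F k in sequentially. norm (displacement n x k) \<le> norm (rot n k - 1) * (3 * m * norm x)"
    by (auto simp: displacement_def norm_mult intro!: always_eventually mult_left_mono norm_coord_le)
  have "(\<lambda>k. norm (rot n k - 1)) \<longlonglongrightarrow> 0"
    using tendsto_diff[OF rot_tendsto_1[of n] tendsto_const[of 1]] by (intro tendsto_norm_zero) simp
  then show "(\<lambda>k. norm (rot n k - 1) * (3 * m * norm x)) \<longlonglongrightarrow> 0"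
    by (rule tendsto_mult_left_zero)
qed

lemma displacement_at_0: "displacement n x 0 = 0"
  by (simp add: displacement_def)

definition T_fun :: "int \<Rightarrow> 'a \<Rightarrow> 'a"
  where "T_fun n x = x + J (interleave (displacement n x))"

lemma interleave_displacement_null: "interleave (displacement n x) \<longlonglongrightarrow> 0"
  by (rule interleave_null[OF displacement_null])

text \<open>The displacement vanishes at index 0, so its own coordinates are unperturbed and add
  \<open>rot n k - 1\<close> times \<open>coord x k\<close>. In coordinates the operators are thus
  diagonal.\<close>

lemma coord_T_fun: "coord (T_fun n x) k = rot n k * coord x k"
  by (simp add: T_fun_def coord_add coord_J_interleave[OF displacement_null displacement_at_0]
      displacement_def algebra_simps)

lemma T_fun_add_exponents: "T_fun (a + b) x = T_fun a (T_fun b x)"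
proof -
  \<comment> \<open>With \<open>u = rot a k\<close> and \<open>v = rot b k\<close> this is
    \<open>u * v - 1 = (v - 1) + (u - 1) * v\<close>.\<close>
  have "displacement (a + b) x = (\<lambda>k. displacement b x k + displacement a (T_fun b x) k)"
    by (simp add: fun_eq_iff displacement_def coord_T_fun rot_add algebra_simps)
  then have "interleave (displacement (a + b) x) =
      (\<lambda>i. interleave (displacement b x) i + interleave (displacement a (T_fun b x)) i)"
    by (simp add: interleave_add)
  then have "T_fun (a + b) x =
      x + (J (interleave (displacement b x)) + J (interleave (displacement a (T_fun b x))))"
    by (simp only: T_fun_def[of "a + b"] add interleave_displacement_null)
  also have "\<dots> = T_fun b x + J (interleave (displacement a (T_fun b x)))"
    by (simp only: T_fun_def[of b x] add.assoc)
  also have "\<dots> = T_fun a (T_fun b x)"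
    by (rule T_fun_def[symmetric])
  finally show ?thesis .
qed

text \<open>The constant is independent of \<open>n\<close>, which makes the whole group
  bounded.\<close>

lemma norm_T_fun_le: "norm (T_fun n x) \<le> norm x * (1 + 6 * m * M)"
proof -
  have "norm (J (interleave (displacement n x))) \<le> M * (2 * (3 * m * norm x))"
    by (intro upper interleave_displacement_null abs_interleave_displacement_le)
  then show ?thesis
    using norm_triangle_ineq[of x "J (interleave (displacement n x))"]
    by (simp add: T_fun_def algebra_simps)
qed

lemma bounded_linear_T_fun: "bounded_linear (T_fun n)"
proof (rule bounded_linear_intro)
  fix x y :: 'a and r :: real
  have "displacement n (x + y) = (\<lambda>k. displacement n x k + displacement n y k)"
    by (simp add: fun_eq_iff displacement_def coord_add distrib_left)
  then have "interleave (displacement n (x + y)) =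
      (\<lambda>i. interleave (displacement n x) i + interleave (displacement n y) i)"
    by (simp add: interleave_add)
  then show "T_fun n (x + y) = T_fun n x + T_fun n y"
    using add[OF interleave_displacement_null interleave_displacement_null]
    by (simp add: T_fun_def)
  have "displacement n (r *\<^sub>R x) = (\<lambda>k. r *\<^sub>R displacement n x k)"
    by (simp add: fun_eq_iff displacement_def coord_scaleR)
  then have "interleave (displacement n (r *\<^sub>R x)) = (\<lambda>i. r * interleave (displacement n x) i)"
    by (simp add: interleave_scaleR)
  then show "T_fun n (r *\<^sub>R x) = r *\<^sub>R T_fun n x"
    using scale[OF interleave_displacement_null] by (simp add: T_fun_def scaleR_add_right)
  show "norm (T_fun n x) \<le> norm x * (1 + 6 * m * M)"
    by (rule norm_T_fun_le)
qed

definition T :: "int \<Rightarrow> 'a \<Rightarrow>\<^sub>L 'a"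
  where "T n = Blinfun (T_fun n)"

lemma T_apply: "blinfun_apply (T n) x = T_fun n x"
  by (simp add: T_def bounded_linear_Blinfun_apply bounded_linear_T_fun)

lemma T_0: "T 0 = id_blinfun"
proof (rule blinfun_eqI)
  fix x
  have "interleave (displacement 0 x) = (\<lambda>_. 0)"
    by (simp add: fun_eq_iff displacement_def interleave_def)
  then show "blinfun_apply (T 0) x = blinfun_apply id_blinfun x"
    by (simp add: T_apply T_fun_def zero)
qed

lemma T_add: "T (a + b) = T a o\<^sub>L T b"
  by (rule blinfun_eqI) (simp add: T_apply T_fun_add_exponents)

lemma bounded_range_T: "bounded (range T)"
proof (rule boundedI)
  fix t assume "t \<in> range T"
  then obtain n where "t = T n" ..
  moreover have "norm (T n) \<le> 1 + 6 * m * M"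
    using M_nonneg m_pos norm_T_fun_le[of n]
    by (intro norm_blinfun_bound) (simp_all add: T_apply mult.commute[of _ "norm _"])
  ultimately show "norm t \<le> 1 + 6 * m * M"
    by simp
qed

text \<open>At an index \<open>k\<close> where the rotation is -1, the coordinate 1 of this vector
  is moved by -2; \<open>lower\<close> at the real coordinate \<open>2 * k\<close> turns this into a
  norm bound.\<close>

lemma displacement_norm_T:
  assumes "n \<noteq> 0"
  shows "norm (blinfun_apply (T n) (J (unit 0)) - J (unit 0)) \<ge> 2 / m"
proof -
  obtain k where k: "k \<noteq> 0" "rot n k = - 1"
    using rot_eq_minus_1[OF assms] .
  have "coord (J (unit 0)) k = 1"
    using k by (simp add: coord_def f_J[OF unit_null] unit_def complex_eq_iff)
  then have "displacement n (J (unit 0)) k = - 2"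
    using k by (simp add: displacement_def)
  then have "2 \<le> m * norm (J (interleave (displacement n (J (unit 0)))))"
    using lower[OF interleave_displacement_null[of n "J (unit 0)"], of "2 * k"] by simp
  then show ?thesis
    using m_pos by (simp add: T_apply T_fun_def field_simps)
qed

lemma T_neq_id: "n \<noteq> 0 \<Longrightarrow> T n \<noteq> id_blinfun"
  using displacement_norm_T[of n] m_pos by auto

text \<open>The displacements are bounded uniformly in \<open>j\<close>, and each fixed coordinate
  \<open>i\<close> is exactly 0 once \<open>j\<close> reaches \<open>i div 2\<close>.\<close>

lemma T_power_of_2_weakly_tendsto:
  fixes h :: "'a \<Rightarrow>\<^sub>L real"
  shows "(\<lambda>j. blinfun_apply h (blinfun_apply (T (2 ^ j)) x)) \<longlonglongrightarrow> blinfun_apply h x"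
proof -
  have "(\<lambda>j. blinfun_apply h (J (interleave (displacement (2 ^ j) x)))) \<longlonglongrightarrow> 0"
  proof (rule weakly_null_if_pointwise_null)
    show "interleave (displacement (2 ^ j) x) \<longlonglongrightarrow> 0" for j
      by (rule interleave_displacement_null)
    show "\<bar>interleave (displacement (2 ^ j) x) i\<bar> \<le> 2 * (3 * m * norm x)" for i j
      by (rule abs_interleave_displacement_le)
    show "(\<lambda>j. interleave (displacement (2 ^ j) x) i) \<longlonglongrightarrow> 0" for i
    proof (rule tendsto_eventually)
      show "\<forall>\<^sub>F j in sequentially. interleave (displacement (2 ^ j) x) i = 0"
        using eventually_ge_at_top[of "i div 2"]
        by eventually_elim (simp add: interleave_def displacement_def rot_power_of_2)
    qed
  qed
  from tendsto_add[OF tendsto_const this]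
  have "(\<lambda>j. blinfun_apply h x + blinfun_apply h (J (interleave (displacement (2 ^ j) x))))
      \<longlonglongrightarrow> blinfun_apply h x + 0" .
  then show ?thesis
    by (simp only: T_apply T_fun_def blinfun.add_right add_0_right)
qed

lemma distinguished_point_range_T: "distinguished_point (range T) (J (unit 0))"
  unfolding distinguished_point_def
proof (rule less_le_trans)
  show "0 < ereal (2 / m)"
    using m_pos by simp
  show "ereal (2 / m) \<le>
      (INF t \<in> range T - {id_blinfun}. ereal (norm (blinfun_apply t (J (unit 0)) - J (unit 0))))"
  proof (rule INF_greatest)
    fix t assume t: "t \<in> range T - {id_blinfun}"
    then obtain n where n: "t = T n"
      by blast
    then have "n \<noteq> 0"
      using t T_0 by (intro notI) simp
    then show "ereal (2 / m) \<le> ereal (norm (blinfun_apply t (J (unit 0)) - J (unit 0)))"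
      unfolding n ereal_less_eq by (rule displacement_norm_T)
  qed
qed

end

section \<open>Operator topologies and groups\<close>

text \<open>Eventual membership passes to finite intersections and arbitrary unions, so subbasic
  sets suffice.\<close>

lemma limitin_weak_operator_topology:
  fixes L :: "'a::real_normed_vector \<Rightarrow>\<^sub>L 'b::real_normed_vector"
  assumes "\<And>(h :: 'b \<Rightarrow>\<^sub>L real) x.
    ((\<lambda>j. blinfun_apply h (blinfun_apply (T j) x)) \<longlongrightarrow> blinfun_apply h (blinfun_apply L x)) F"
  shows "limitin weak_operator_topology T L F"
proof -
  have "\<forall>\<^sub>F j in F. T j \<in> U" if "openin weak_operator_topology U" "L \<in> U" for U
    using openin_topology_generated_by[OF that(1)[unfolded weak_operator_topology_def]] that(2)
  proof induction
    case (Int a b)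
    then show ?case
      by (simp add: eventually_conj)
  next
    case (UN K)
    then obtain k where "k \<in> K" "L \<in> k"
      by blast
    then show ?case
      using UN.IH[of k] by (auto elim: eventually_mono)
  next
    case (Basis s)
    then obtain h :: "'b \<Rightarrow>\<^sub>L real" and x V where
      "s = (\<lambda>T. blinfun_apply h (blinfun_apply T x)) -` V" "open V"
      by blast
    then show ?case
      using topological_tendstoD[OF assms, of V h x] Basis by simp
  qed simp
  then show ?thesis
    by (simp add: limitin_def)
qed

lemma not_openin_weak_if_weak_limit:
  assumes "limitin weak_operator_topology T L sequentially"
    and "\<And>j. T j \<in> G" and "\<And>j. T j \<noteq> L"
  shows "\<not> openin (subtopology weak_operator_topology G) {L}"
proof
  assume "openin (subtopology weak_operator_topology G) {L}"
  then obtain U where "openin weak_operator_topology U" "{L} = U \<inter> G"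
    by (auto simp: openin_subtopology)
  then have "\<forall>\<^sub>F j in sequentially. T j \<in> {L}"
    using assms(1,2) by (auto simp: limitin_def)
  then have "\<forall>\<^sub>F j in sequentially. False"
    using assms(3) by simp
  then show False
    by simp
qed

lemma distinguished_point_imp_openin_strong:
  assumes "distinguished_point G x" and "id_blinfun \<in> G"
  shows "openin (subtopology strong_operator_topology G) {id_blinfun}"
proof -
  \<comment> \<open>The infimum may be infinite, hence a real number strictly between 0 and
    it.\<close>
  obtain e where "ereal e > 0"
    and e: "ereal e < (INF T \<in> G - {id_blinfun}. ereal (norm (blinfun_apply T x - x)))"
    using ereal_dense2 assms(1) unfolding distinguished_point_def by blast
  have "T = id_blinfun" if "T \<in> G" "norm (blinfun_apply T x - x) < e" for T
    using that less_INF_D[OF e, of T] by auto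
  then have "{id_blinfun} = {T. blinfun_apply T x \<in> ball x e} \<inter> G"
    using \<open>ereal e > 0\<close> assms(2) by (auto simp: dist_norm norm_minus_commute)
  moreover have "openin strong_operator_topology {T. blinfun_apply T x \<in> ball x e}"
    using strong_operator_topology_basis[of "{()}" "\<lambda>_. ball x e" "\<lambda>_. x"] by simp
  ultimately show ?thesis
    by (auto simp: openin_subtopology)
qed

lemma group_GL: "group GL"
  unfolding GL_def
proof (rule monoid.units_group, rule monoidI, simp_all)
  fix x y z :: "'a::real_normed_vector \<Rightarrow>\<^sub>L 'a"
  show "x o\<^sub>L y o\<^sub>L z = x o\<^sub>L (y o\<^sub>L z)" "id_blinfun o\<^sub>L x = x" "x o\<^sub>L id_blinfun = x"
    by (rule blinfun_eqI, simp)+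
qed

text \<open>The hypotheses make \<open>T\<close> a homomorphism from the integers to
  \<open>GL\<close>, with \<open>T (- n)\<close> inverse to \<open>T n\<close>; images of cyclic
  groups are cyclic.\<close>

lemma one_parameter_range_GL:
  fixes T :: "int \<Rightarrow> 'a::real_normed_vector \<Rightarrow>\<^sub>L 'a"
  assumes "T 0 = id_blinfun" and add: "\<And>a b. T (a + b) = T a o\<^sub>L T b"
  shows "subgroup (range T) GL" and "cyclic_group (GL\<lparr>carrier := range T\<rparr>)"
proof -
  have hom: "T \<in> hom integer_group GL"
  proof (rule homI)
    show "T n \<in> carrier GL" for n
      unfolding carrier_GL using add[of "- n" n] add[of n "- n"] assms(1)
      by (intro CollectI exI[of _ "T (- n)"]) simp
    show "T (a \<otimes>\<^bsub>integer_group\<^esub> b) = T a \<otimes>\<^bsub>GL\<^esub> T b" for a b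
      by (simp add: add GL_def units_of_def)
  qed
  interpret group_hom integer_group GL T
    by (simp add: group_hom_def group_hom_axioms_def group_GL hom)
  show sub: "subgroup (range T) GL"
    using img_is_subgroup by simp
  have "T \<in> epi integer_group (GL\<lparr>carrier := range T\<rparr>)"
    using hom by (auto simp: epi_def hom_def)
  then show "cyclic_group (GL\<lparr>carrier := range T\<rparr>)"
    using group.cyclic_group_epimorphic_image[OF group_integer_group _ cyclic_integer_group]
      subgroup.subgroup_is_group[OF sub group_GL] by blast
qed

theorem theorem4p6:
  assumes "separable_space (euclidean :: 'a::banach topology)"
    and "contains_copy_of_c0 TYPE('a)"
  shows "\<exists>G :: ('a \<Rightarrow>\<^sub>L 'a) set.
    subgroup G GL \<and> cyclic_group (GL\<lparr>carrier := G\<rparr>) \<and> bounded G \<and>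
    WOT_indiscrete G \<and> (\<exists>x. distinguished_point G x) \<and> \<not> light G"
proof -
  obtain J :: "(nat \<Rightarrow> real) \<Rightarrow> 'a" and M m where "c0_embedding J M m"
    using contains_copy_of_c0_imp_embedding[OF assms(2)] .
  then interpret c0_embedding J M m .
  obtain f :: "nat \<Rightarrow> 'a \<Rightarrow>\<^sub>L real"
    where "\<And>n s. s \<longlonglongrightarrow> 0 \<Longrightarrow> blinfun_apply (f n) (J s) = s n"
      and "\<And>n x. \<bar>blinfun_apply (f n) x\<bar> \<le> m * norm x"
    using coordinate_functionals by blast
  then interpret c0_rotations J M m f
    by unfold_locales
  have id: "id_blinfun \<in> range T"
    using T_0 by (metis rangeI)
  have "limitin weak_operator_topology (\<lambda>j. T (2 ^ j)) id_blinfun sequentially"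
    using T_power_of_2_weakly_tendsto by (intro limitin_weak_operator_topology) simp
  then have not_open: "\<not> openin (subtopology weak_operator_topology (range T)) {id_blinfun}"
    by (rule not_openin_weak_if_weak_limit) (simp_all add: T_neq_id)
  then have "WOT_indiscrete (range T)"
    using id by (auto simp: WOT_indiscrete_def)
  \<comment> \<open>The identity is isolated in the strong topology but not in the weak one.\<close>
  moreover have "\<not> light (range T)"
    using not_open distinguished_point_imp_openin_strong[OF distinguished_point_range_T id]
    by (auto simp: light_def)
  ultimately show ?thesis
    using one_parameter_range_GL[of T, OF T_0 T_add] bounded_range_T distinguished_point_range_T
    by blast
qed

end
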